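(* Let $\mathcal{G}$ be the first Grigorchuk group and let $\{a_n\}_{n=0}^\infty$ be its portrait growth sequence (with respect to the nucleus of $\mathcal{G}$). There exists a positive constant $\gamma$ such that $$\frac{1}{4} e^{\gamma 2^n} \leq a_n \leq 4 e^{\gamma 2^n}\quad\text{for all } n \geq 0.$$ Moreover, $\gamma\approx 0.71$.
   Context: Let $X=\{1,\dots,m\}$ and let $T$ be the $m$-adic rooted tree whose vertices are the finite words over $X$, with $u$ joined to $ux$ for $x \in X$; words of length $n$ form level $n$. $\operatorname{Aut} T$ is the group of automorphisms of this rooted tree. Every $g\in\operatorname{Aut} T$ is written $g=(g_1,\dots,g_m)\alpha$ with $\alpha\in S_m$ and $g_i\in \operatorname{Aut} T$, meaning $g(iw)=\alpha(i)\,g_i(w)$ for $i\in X$ and every word $w$; $g_i$ is the section of $g$ at $i$. The section $g_u$ at any vertex $u$ is defined by $g(uw)=g(u)g_u(w)$. Products are composed so that $gh$ means first $g$, then $h$, i.e. $(gh)_u=g_u h_{g(u)}$. A group $G\le\operatorname{Aut} T$ is self-similar if all sections of its elements lie in $G$. A self-similar group $G$ is contracting if there is a finite set $\mathcal{M}\subseteq G$ such that for every $g\in G$ there is a level $n$ such that all sections of $g$ at vertices at and below level $n$ belong to $\mathcal{M}$. The smallest such $\mathcal{M}$ is the nucleus $\mathcal{N}(G)$. For a contracting group $G$, the nucleus portrait of $g\in G$ is the finite decorated rooted tree defined recursively: if $g\in\mathcal{N}(G)$, it is a single root decorated by $g$; otherwise, with $g=(g_1,\dots,g_m)\alpha$,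 the root is decorated by $\alpha$ and the portraits of $g_1,\dots,g_m$ are attached at the $m$ vertices of level 1. The depth of $g$ is the length of the longest path from the root to a leaf of its portrait. The portrait growth sequence of a finitely generated contracting group $G$ is $a_n=|\{g\in G\mid \text{the depth of } g \text{ is at most } n\}|$, $n\ge 0$. The first Grigorchuk group $\mathcal{G}$ is the group of automorphisms of the binary tree ($m=2$) generated by $a=(1,1)(1\,2)$ and the elements $b,c,d$ fixing level 1 and defined recursively by $b=(a,c)$, $c=(a,d)$, $d=(1,b)$. It is contracting with nucleus $\{1,a,b,c,d\}$. *)

theory Defs
  imports Complex_Main "HOL-Algebra.Generated_Groups"
begin

text \<open>
  The alphabet $X$ is the (finite) type \<open>'x\<close>, so that $m$ is the cardinality of \<open>'x\<close>; the vertices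
  of the $m$-adic tree are the words of type \<open>'x list\<close>, with the empty word as root.
\<close>

definition tree_edge :: "'x list \<Rightarrow> 'x list \<Rightarrow> bool" where
  "tree_edge u v \<longleftrightarrow> (\<exists>x. v = u @ [x]) \<or> (\<exists>x. u = v @ [x])"

definition tree_aut :: "('x list \<Rightarrow> 'x list) \<Rightarrow> bool" where
  "tree_aut g \<longleftrightarrow> bij g \<and> g [] = [] \<and> (\<forall>u v. tree_edge (g u) (g v) \<longleftrightarrow> tree_edge u v)"

text \<open>The product $gh$ means first $g$, then $h$.\<close>

definition Aut_tree :: "('x list \<Rightarrow> 'x list) monoid" where
  "Aut_tree = \<lparr>carrier = {g. tree_aut g}, mult = (\<lambda>g h. h \<circ> g), one = id\<rparr>"

text \<open>
  The section $g_u$ is characterised by $g(uw) = g(u)\,g_u(w)$; it is obtained by removing the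
  prefix $g(u)$ from $g(uw)$. See \<open>tree_section_eq\<close> below.
\<close>

definition tree_section :: "('x list \<Rightarrow> 'x list) \<Rightarrow> 'x list \<Rightarrow> 'x list \<Rightarrow> 'x list" where
  "tree_section g u w = drop (length (g u)) (g (u @ w))"

definition root_perm :: "('x list \<Rightarrow> 'x list) \<Rightarrow> 'x \<Rightarrow> 'x" where
  "root_perm g x = hd (g [x])"

definition self_similar :: "('x list \<Rightarrow> 'x list) set \<Rightarrow> bool" where
  "self_similar G \<longleftrightarrow> subgroup G Aut_tree \<and> (\<forall>g\<in>G. \<forall>u. tree_section g u \<in> G)"

definition absorbing :: "('x list \<Rightarrow> 'x list) set \<Rightarrow> ('x list \<Rightarrow> 'x list) set \<Rightarrow> bool" where
  "absorbing G M \<longleftrightarrow> finite M \<and> M \<subseteq> G \<and>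
     (\<forall>g\<in>G. \<exists>n. \<forall>u. n \<le> length u \<longrightarrow> tree_section g u \<in> M)"

definition contracting :: "('x list \<Rightarrow> 'x list) set \<Rightarrow> bool" where
  "contracting G \<longleftrightarrow> self_similar G \<and> (\<exists>M. absorbing G M)"

text \<open>\<open>LEAST\<close> refers to the inclusion order on sets.\<close>

definition nucleus :: "('x list \<Rightarrow> 'x list) set \<Rightarrow> ('x list \<Rightarrow> 'x list) set" where
  "nucleus G = (LEAST M. absorbing G M)"

datatype 'x portrait =
    Leaf "'x list \<Rightarrow> 'x list"
  | Node "'x \<Rightarrow> 'x" "'x \<Rightarrow> 'x portrait"

text \<open>
  The recursion defining the portrait terminates only for elements of a contracting group;
  therefore its graph is defined inductively, with \<open>N\<close> in the role of the nucleus.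
\<close>

inductive has_portrait ::
    "('x list \<Rightarrow> 'x list) set \<Rightarrow> ('x list \<Rightarrow> 'x list) \<Rightarrow> 'x portrait \<Rightarrow> bool"
  for N where
  leaf: "g \<in> N \<Longrightarrow> has_portrait N g (Leaf g)"
| node: "g \<notin> N \<Longrightarrow> (\<And>x. has_portrait N (tree_section g [x]) (P x)) \<Longrightarrow>
         has_portrait N g (Node (root_perm g) P)"

definition nucleus_portrait ::
    "('x list \<Rightarrow> 'x list) set \<Rightarrow> ('x list \<Rightarrow> 'x list) \<Rightarrow> 'x portrait" where
  "nucleus_portrait G g = (THE p. has_portrait (nucleus G) g p)"

primrec portrait_height :: "'x::finite portrait \<Rightarrow> nat" where
  "portrait_height (Leaf g) = 0"
| "portrait_height (Node \<alpha> P) = Suc (Max (range (\<lambda>x. portrait_height (P x))))"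

definition portrait_depth ::
    "('x::finite list \<Rightarrow> 'x list) set \<Rightarrow> ('x list \<Rightarrow> 'x list) \<Rightarrow> nat" where
  "portrait_depth G g = portrait_height (nucleus_portrait G g)"

definition portrait_growth :: "('x::finite list \<Rightarrow> 'x list) set \<Rightarrow> nat \<Rightarrow> nat" where
  "portrait_growth G n = card {g \<in> G. portrait_depth G g \<le> n}"

text \<open>Binary alphabet: \<open>False\<close> is the letter $1$ and \<open>True\<close> is the letter $2$.\<close>

fun grig_a :: "bool list \<Rightarrow> bool list" where
  "grig_a [] = []"
| "grig_a (x # w) = (\<not> x) # w"

fun grig_b grig_c grig_d :: "bool list \<Rightarrow> bool list" where
  "grig_b [] = []"
| "grig_b (False # w) = False # grig_a w"
| "grig_b (True # w) = True # grig_c w"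
| "grig_c [] = []"
| "grig_c (False # w) = False # grig_a w"
| "grig_c (True # w) = True # grig_d w"
| "grig_d [] = []"
| "grig_d (False # w) = False # w"
| "grig_d (True # w) = True # grig_b w"

definition Grigorchuk :: "(bool list \<Rightarrow> bool list) set" where
  "Grigorchuk = generate Aut_tree {grig_a, grig_b, grig_c, grig_d}"

lemma tree_aut_snoc:
  assumes g: "tree_aut g"
  shows "\<exists>y. g (u @ [x]) = g u @ [y]"
proof -
  have edge: "tree_edge (g v) (g (v @ [x]))" for v x
  proof -
    have "tree_edge v (v @ [x])" by (auto simp: tree_edge_def)
    then show ?thesis using g unfolding tree_aut_def by blast
  qed
  show ?thesis
  proof (induction u arbitrary: x rule: rev_induct)
    case Nil
    have root: "g [] = []" using g by (simp add: tree_aut_def)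
    show ?case
      using edge[of "[]" x] by (simp add: root tree_edge_def)
  next
    case (snoc z u)
    let ?v = "u @ [z]"
    consider y where "g (?v @ [x]) = g ?v @ [y]" | y where "g ?v = g (?v @ [x]) @ [y]"
      using edge[of ?v x] unfolding tree_edge_def by blast
    then show ?case
    proof cases
      case 1
      then show ?thesis by blast
    next
      case 2
      obtain y' where "g ?v = g u @ [y']" using snoc by blast
      with 2 have "g (?v @ [x]) = g u" by simp
      then have "?v @ [x] = u"
        using g unfolding tree_aut_def bij_def by (metis injD)
      then have "length (?v @ [x]) = length u" by metis
      then show ?thesis by simp
    qed
  qed
qed

lemma tree_section_eq:
  assumes g: "tree_aut g"
  shows "g (u @ w) = g u @ tree_section g u w"
proof -
  have "\<exists>w'. g (u @ w) = g u @ w'"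
  proof (induction w rule: rev_induct)
    case (snoc x w)
    then show ?case
      using tree_aut_snoc[OF g, of "u @ w" x] by (metis append.assoc)
  qed simp
  then show ?thesis by (auto simp: tree_section_def)
qed

end

theory Submission
  imports Defs
begin

text \<open>
  Let $B$ be the normal closure of $b$ and $K$ that of $(ab)^2$. An element of $\mathcal G$ amounts
  to a permutation of level 1 and a pair of sections whose images in $\mathcal{G}/B$ correspond to
  each other under the automorphism exchanging $a$ and $d$, and the class of the element modulo $K$
  is a function of the permutation and the classes of the sections. Hence the numbers of elements
  of depth at most $n$ in the 16 classes satisfy a quadratic recursion. It gives
  $a_{n+1} = a_n^2/4 + D_n^2$ for $n \ge 1$, where $D_n$ is half the difference of the numbers of
  elements in two disjoint unions of classes, so that $|D_n| \le a_n/2$. Consequently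
  $\ln(a_n/4)/2^n$ is increasing, $\ln(a_n/2)/2^n$ is decreasing, and $\gamma$ is their common limit,
  which the terms for $n = 2$ and $n = 8$ locate.
\<close>

subsection \<open>The generators and their sections\<close>

text \<open>The element (s, t)\<alpha> of the wreath recursion, \<open>p\<close> saying whether
  \<alpha> is the transposition. On booleans \<open>x \<noteq> p\<close> is exclusive or, hence
  \<alpha>(x).\<close>

definition node :: "bool \<Rightarrow> (bool list \<Rightarrow> bool list) \<Rightarrow> (bool list \<Rightarrow> bool list) \<Rightarrow> bool list \<Rightarrow> bool list" where
  "node p s t w = (case w of [] \<Rightarrow> [] | x # v \<Rightarrow> (x \<noteq> p) # (if x then t v else s v))"

lemma node_simps [simp]:
  "node p s t [] = []"
  "node p s t (x # v) = (x \<noteq> p) # (if x then t v else s v)"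
  by (simp_all add: node_def)

lemma node_eqI: "f [] = [] \<Longrightarrow> (\<And>x v. f (x # v) = (x \<noteq> p) # (if x then t v else s v)) \<Longrightarrow> f = node p s t"
  by (rule ext) (simp add: node_def split: list.split)

lemma tree_section_Nil [simp]: "g [] = [] \<Longrightarrow> tree_section g [] = g"
  by (rule ext) (simp add: tree_section_def)

lemma tree_section_node [simp]:
  "tree_section (node p s t) (x # u) = tree_section (if x then t else s) u"
  by (rule ext) (simp add: tree_section_def)

lemma root_perm_node [simp]: "root_perm (node p s t) x = (x \<noteq> p)"
  by (simp add: root_perm_def)

text \<open>The right factor acts first, against the order of the product in
  \<open>Aut_tree\<close>; so the left factor contributes its section at the letter already moved by
  \<open>q\<close>.\<close>

lemma node_comp:
  "node p s t \<circ> node q s' t' =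
   node (p \<noteq> q) (if q then t \<circ> s' else s \<circ> s') (if q then s \<circ> t' else t \<circ> t')"
  by (rule node_eqI) auto

lemma node_inject [simp]: "node p s t = node p' s' t' \<longleftrightarrow> p = p' \<and> s = s' \<and> t = t'"
proof
  assume eq: "node p s t = node p' s' t'"
  have "node p s t [False] = node p' s' t' [False]" by (simp only: eq)
  moreover have "s v = s' v" for v using fun_cong[OF eq, of "False # v"] by simp
  moreover have "t v = t' v" for v using fun_cong[OF eq, of "True # v"] by simp
  ultimately show "p = p' \<and> s = s' \<and> t = t'" by auto
qed simp

lemma id_node: "id = node False id id"
  by (rule node_eqI) auto

lemma grig_a_node: "grig_a = node True id id"
  by (rule node_eqI) auto

lemma grig_b_node: "grig_b = node False grig_a grig_c"
proof (rule node_eqI)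
  show "grig_b (x # v) = (x \<noteq> False) # (if x then grig_c v else grig_a v)" for x v
    by (cases x) auto
qed simp

lemma grig_c_node: "grig_c = node False grig_a grig_d"
proof (rule node_eqI)
  show "grig_c (x # v) = (x \<noteq> False) # (if x then grig_d v else grig_a v)" for x v
    by (cases x) auto
qed simp

lemma grig_d_node: "grig_d = node False id grig_b"
proof (rule node_eqI)
  show "grig_d (x # v) = (x \<noteq> False) # (if x then grig_b v else id v)" for x v
    by (cases x) auto
qed simp

abbreviation "grig_gens \<equiv> {grig_a, grig_b, grig_c, grig_d}"
definition grig_nuc :: "(bool list \<Rightarrow> bool list) set" where
  "grig_nuc = {id, grig_a, grig_b, grig_c, grig_d}"

lemma length_grig:
  "length (grig_a w) = length w" "length (grig_b w) = length w"
  "length (grig_c w) = length w" "length (grig_d w) = length w"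
proof -
  show "length (grig_a w) = length w" for w by (cases w) auto
  then show "length (grig_b w) = length w" "length (grig_c w) = length w"
     "length (grig_d w) = length w"
    by (induction w rule: grig_b_grig_c_grig_d.induct) auto
qed

lemma grig_involution:
  "grig_a (grig_a w) = w" "grig_b (grig_b w) = w" "grig_c (grig_c w) = w" "grig_d (grig_d w) = w"
proof -
  show "grig_a (grig_a w) = w" for w by (cases w) auto
  then show "grig_b (grig_b w) = w" "grig_c (grig_c w) = w" "grig_d (grig_d w) = w"
    by (induction w rule: grig_b_grig_c_grig_d.induct) auto
qed

lemma grig_involution_comp:
  "grig_a \<circ> grig_a = id" "grig_b \<circ> grig_b = id" "grig_c \<circ> grig_c = id" "grig_d \<circ> grig_d = id"
  by (auto simp: fun_eq_iff grig_involution)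

lemma nuc_node_ex: "f \<in> grig_nuc \<Longrightarrow> \<exists>p s t. f = node p s t \<and> s \<in> grig_nuc \<and> t \<in> grig_nuc"
  unfolding grig_nuc_def
  by (elim insertE emptyE; simp only:; intro exI conjI)
     (rule id_node grig_a_node grig_b_node grig_c_node grig_d_node | simp)+

text \<open>Claimed for all five maps at once because their sections are again among them, which
  closes the induction on the word.\<close>

lemma grig_snoc: "f \<in> grig_nuc \<Longrightarrow> \<exists>y. f (w @ [x]) = f w @ [y]"
proof (induction w arbitrary: f)
  case Nil
  obtain p s t where f: "f = node p s t" and st: "s \<in> grig_nuc" "t \<in> grig_nuc"
    using nuc_node_ex[OF Nil] by blast
  have "s [] = []" "t [] = []" using st by (auto simp: grig_nuc_def)
  then show ?case by (simp add: f)
next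
  case (Cons z w)
  obtain p s t where f: "f = node p s t" and st: "s \<in> grig_nuc" "t \<in> grig_nuc"
    using nuc_node_ex[OF Cons(2)] by blast
  show ?case using Cons(1)[OF st(1)] Cons(1)[OF st(2)] by (simp add: f)
qed

lemma tree_aut_involution:
  assumes inv: "\<And>w. g (g w) = w" and len: "\<And>w. length (g w) = length w"
    and snoc: "\<And>w x. \<exists>y. g (w @ [x]) = g w @ [y]"
  shows "tree_aut g"
proof -
  have edge: "tree_edge (g u) (g v)" if "tree_edge u v" for u v
    using that snoc unfolding tree_edge_def by blast
  have "tree_edge u v" if "tree_edge (g u) (g v)" for u v
    using edge[OF that] by (simp add: inv)
  moreover have "bij g" using inv by (metis involuntory_imp_bij)
  moreover have "g [] = []" using len[of "[]"] by simp
  ultimately show ?thesis using edge unfolding tree_aut_def by blast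
qed

lemma tree_aut_grig: "g \<in> grig_gens \<Longrightarrow> tree_aut g"
  by (elim insertE emptyE; simp only:; rule tree_aut_involution)
    (rule grig_involution length_grig grig_snoc; simp add: grig_nuc_def)+

lemma inv_Aut_tree_involution:
  assumes "tree_aut g" "g \<circ> g = id"
  shows "inv\<^bsub>Aut_tree\<^esub> g = g"
proof -
  have "h = g" if "g \<circ> h = id" for h
    using that assms(2) by (metis comp_assoc comp_id id_comp)
  then show ?thesis
    unfolding m_inv_def using assms by (intro the_equality) (auto simp: Aut_tree_def)
qed

section \<open>Induction over words in the generators; sections of group elements\<close>

lemma grig_incl: "s \<in> grig_gens \<Longrightarrow> s \<in> Grigorchuk"
  unfolding Grigorchuk_def by (rule generate.incl)

lemma grig_comp: "g \<in> Grigorchuk \<Longrightarrow> h \<in> Grigorchuk \<Longrightarrow> g \<circ> h \<in> Grigorchuk"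
  unfolding Grigorchuk_def using generate.eng[of h Aut_tree _ g] by (simp add: Aut_tree_def)

lemma id_grig: "id \<in> Grigorchuk"
  unfolding Grigorchuk_def using generate.one[of Aut_tree] by (simp add: Aut_tree_def)

text \<open>Words without inverses suffice since the generators are involutions.\<close>

lemma grig_induct [consumes 1, case_names id step]:
  assumes "g \<in> Grigorchuk" and id: "P id"
    and step: "\<And>s g. s \<in> grig_gens \<Longrightarrow> g \<in> Grigorchuk \<Longrightarrow> P g \<Longrightarrow> P (s \<circ> g)"
  shows "P g"
proof -
  \<comment> \<open>That left multiplication by \<open>g\<close> preserves \<open>P\<close> is a
    claim that passes to products, unlike \<open>P g\<close> itself.\<close>
  have "\<forall>h \<in> Grigorchuk. P h \<longrightarrow> P (g \<circ> h)"
    using assms(1) unfolding Grigorchuk_def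
  proof (induction rule: generate.induct)
    case one
    then show ?case by (simp add: Aut_tree_def)
  next
    case (incl s)
    then show ?case using step unfolding Grigorchuk_def by blast
  next
    case (inv s)
    then have "s \<circ> s = id" using grig_involution_comp by auto
    then have "inv\<^bsub>Aut_tree\<^esub> s = s"
      using inv inv_Aut_tree_involution tree_aut_grig by blast
    then show ?case using step inv unfolding Grigorchuk_def by metis
  next
    case (eng h1 h2)
    have "h2 \<circ> (h1 \<circ> h) = (h1 \<otimes>\<^bsub>Aut_tree\<^esub> h2) \<circ> h" for h
      by (simp add: Aut_tree_def comp_assoc)
    moreover have "P (h2 \<circ> (h1 \<circ> h))" if "h \<in> Grigorchuk" "P h" for h
      using that eng grig_comp unfolding Grigorchuk_def by blast
    ultimately show ?case by (metis Grigorchuk_def)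
  qed
  then show ?thesis using id id_grig by (metis comp_id)
qed

lemma grig_inverse: "g \<in> Grigorchuk \<Longrightarrow> \<exists>h\<in>Grigorchuk. g \<circ> h = id \<and> h \<circ> g = id"
proof (induction rule: grig_induct)
  case id
  then show ?case using id_grig by (intro bexI[of _ id]) auto
next
  case (step s g)
  then obtain h where h: "h \<in> Grigorchuk" "g \<circ> h = id" "h \<circ> g = id" by blast
  have ss: "s \<circ> s = id" using step(1) grig_involution_comp by auto
  have 1: "(s \<circ> g) \<circ> (h \<circ> s) = s \<circ> (g \<circ> h) \<circ> s" by (simp only: comp_assoc)
  have 2: "(h \<circ> s) \<circ> (s \<circ> g) = h \<circ> (s \<circ> s) \<circ> g" by (simp only: comp_assoc)
  have "h \<circ> s \<in> Grigorchuk" using h step grig_incl grig_comp by blast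
  moreover have "(s \<circ> g) \<circ> (h \<circ> s) = id" unfolding 1 h by (simp add: ss)
  moreover have "(h \<circ> s) \<circ> (s \<circ> g) = id" unfolding 2 ss by (simp add: h)
  ultimately show ?case by blast
qed

definition sec :: "(bool list \<Rightarrow> bool list) \<Rightarrow> bool \<Rightarrow> bool list \<Rightarrow> bool list" where
  "sec g x = tree_section g [x]"

definition act :: "(bool list \<Rightarrow> bool list) \<Rightarrow> bool" where
  "act g = root_perm g False"

lemma act_node [simp]: "act (node p s t) = p"
  by (simp add: act_def)

lemma grig_Nil: "g \<in> Grigorchuk \<Longrightarrow> g [] = []"
  by (induction rule: grig_induct) auto

lemma grig_node_ex:
  "g \<in> Grigorchuk \<Longrightarrow> \<exists>p s t. g = node p s t \<and> s \<in> Grigorchuk \<and> t \<in> Grigorchuk"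
proof (induction rule: grig_induct)
  case id
  then show ?case using id_node id_grig by blast
next
  case (step r g)
  then obtain p s t where g: "g = node p s t" "s \<in> Grigorchuk" "t \<in> Grigorchuk" by blast
  obtain p' s' t' where r: "r = node p' s' t'" "s' \<in> Grigorchuk" "t' \<in> Grigorchuk"
    using nuc_node_ex[of r] step(1) grig_incl id_grig unfolding grig_nuc_def by blast
  show ?case
    using g r unfolding g(1) r(1) node_comp by (auto intro!: grig_comp)
qed

lemma sec_node: "s [] = [] \<Longrightarrow> t [] = [] \<Longrightarrow> sec (node p s t) x = (if x then t else s)"
  by (simp add: sec_def)

lemma sec_grig [simp]: "g \<in> Grigorchuk \<Longrightarrow> sec g x \<in> Grigorchuk"
  using grig_node_ex[of g] by (auto simp: sec_node grig_Nil)

lemma grig_eq_node: "g \<in> Grigorchuk \<Longrightarrow> g = node (act g) (sec g False) (sec g True)"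
  using grig_node_ex[of g] by (auto simp: sec_node grig_Nil)

lemma tree_section_grig_Cons:
  "g \<in> Grigorchuk \<Longrightarrow> tree_section g (x # u) = tree_section (sec g x) u"
  using grig_node_ex[of g] by (auto simp: sec_node grig_Nil)

lemma act_comp: "g \<in> Grigorchuk \<Longrightarrow> h \<in> Grigorchuk \<Longrightarrow> act (g \<circ> h) = (act g \<noteq> act h)"
  using grig_node_ex[of g] grig_node_ex[of h] by (auto simp: node_comp)

lemma sec_comp:
  "g \<in> Grigorchuk \<Longrightarrow> h \<in> Grigorchuk \<Longrightarrow> sec (g \<circ> h) x = sec g (x \<noteq> act h) \<circ> sec h x"
  using grig_node_ex[of g] grig_node_ex[of h]
  by (auto simp: node_comp sec_node grig_Nil)

lemma grig_act [simp]:
  "act id = False" "act grig_a = True" "act grig_b = False" "act grig_c = False" "act grig_d = False"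
  using grig_a_node grig_b_node grig_c_node grig_d_node id_node act_node by metis+

lemma grig_sec [simp]:
  "sec id x = id" "sec grig_a x = id"
  "sec grig_b x = (if x then grig_c else grig_a)"
  "sec grig_c x = (if x then grig_d else grig_a)"
  "sec grig_d x = (if x then grig_b else id)"
  using grig_a_node grig_b_node grig_c_node grig_d_node id_node
  by (metis sec_node grig_a.simps(1) grig_b.simps(1) grig_c.simps(1) grig_d.simps(1) id_apply)+

subsection \<open>The quotient of order 16 and the pairs of sections\<close>

text \<open>
  \<open>tau\<close> is the parity of the number of letters $b$, $c$ in any word representing $g$. The triple
  \<open>(act g, ups g False, ups g True)\<close> is the image of $g$ in $C_2 \wr C_2 \cong \mathcal{G}/B$,
  where $B$ is the normal closure of $b$; together with \<open>tau\<close> it describes the quotient of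
  order 16 by the branching subgroup $K = \langle (ab)^2\rangle^{\mathcal G}$.
\<close>

definition tau :: "(bool list \<Rightarrow> bool list) \<Rightarrow> bool" where
  "tau g = (act (sec g False) \<noteq> act (sec g True))"

definition ups :: "(bool list \<Rightarrow> bool list) \<Rightarrow> bool \<Rightarrow> bool" where
  "ups g x = (tau (sec g x) \<noteq> act (sec g (\<not> x)))"

definition cls :: "(bool list \<Rightarrow> bool list) \<Rightarrow> bool \<times> bool \<times> bool \<times> bool" where
  "cls g = (act g, ups g False, ups g True, tau g)"

text \<open>Defined through sections, \<open>tau\<close> depends on the element only;
  multiplicativity and the values in \<open>grig_tau\<close> identify it with the parity of the
  letters b, c. A swap by \<open>h\<close> only permutes the two summands.\<close>

lemma tau_comp:
  assumes "g \<in> Grigorchuk" "h \<in> Grigorchuk" shows "tau (g \<circ> h) = (tau g \<noteq> tau h)"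
  using assms by (cases "act h") (auto simp: tau_def sec_comp act_comp)

text \<open>Together with \<open>act_comp\<close> this is the multiplication of C_2 wr C_2; it
  reduces to the multiplicativity of \<open>tau\<close> and \<open>act\<close> on the
  sections.\<close>

lemma ups_comp:
  assumes "g \<in> Grigorchuk" "h \<in> Grigorchuk"
  shows "ups (g \<circ> h) x = (ups g (x \<noteq> act h) \<noteq> ups h x)"
  using assms by (cases "act h"; cases x) (auto simp: ups_def tau_comp sec_comp act_comp)

lemma grig_tau [simp]:
  "tau id = False" "tau grig_a = False" "tau grig_b = True" "tau grig_c = True" "tau grig_d = False"
  by (simp_all add: tau_def)

lemma grig_ups [simp]:
  "ups id x = False" "ups grig_a x = False" "ups grig_b x = False" "ups grig_c x = x" "ups grig_d x = x"
  by (simp_all add: ups_def)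

text \<open>
  \<open>(s, t)\<close> is the pair of sections of an element of the group iff the image of \<open>t\<close> in
  $\mathcal{G}/B = \langle a, d\rangle$ is obtained from that of \<open>s\<close> by the automorphism exchanging
  $a$ and $d$; the formulas below are this automorphism in the coordinates of $C_2 \wr C_2$.
\<close>

definition compatible :: "(bool list \<Rightarrow> bool list) \<Rightarrow> (bool list \<Rightarrow> bool list) \<Rightarrow> bool" where
  "compatible s t \<longleftrightarrow> act t = (ups s False \<noteq> ups s True) \<and> ups t False = ups s (act s) \<and>
     ups t True = (act s \<noteq> ups s (act s))"

text \<open>Exchanging a and d is a homomorphism; in coordinates this is a finite check over the
  values for \<open>s\<close> and \<open>s'\<close>.\<close>

lemma compatible_comp:
  assumes "s \<in> Grigorchuk" "t \<in> Grigorchuk" "s' \<in> Grigorchuk" "t' \<in> Grigorchuk"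
    and st: "compatible s t" and st': "compatible s' t'"
  shows "compatible (s \<circ> s') (t \<circ> t')"
  using st st' unfolding compatible_def
  by (cases "act s"; cases "ups s False"; cases "ups s True";
      cases "act s'"; cases "ups s' False"; cases "ups s' True")
    (simp_all add: act_comp ups_comp assms(1-4))

lemma compatible_sections:
  "g \<in> Grigorchuk \<Longrightarrow> compatible (sec g False) (sec g True)"
proof (induction rule: grig_induct)
  case id
  \<comment> \<open>The induction method unfolds \<open>id\<close> and \<open>\<circ>\<close> in the goal; this is undone at the end of each case.\<close>
  have "compatible (sec id False) (sec id True)" by (simp add: compatible_def)
  then show ?case by (simp only: id_def)
next
  case (step r g)
  \<comment> \<open>Both orders are needed, since a swap by \<open>g\<close> interchanges the
    sections of \<open>r\<close>; the exchange of a and d is an involution.\<close>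
  have r: "compatible (sec r x) (sec r (\<not> x))" for x
    using step(1) by (cases x) (elim insertE emptyE; simp add: compatible_def)+
  have rG: "r \<in> Grigorchuk" using step(1) by (rule grig_incl)
  have "compatible (sec r (act g) \<circ> sec g False) (sec r (\<not> act g) \<circ> sec g True)"
    using r[of "act g"] step rG by (intro compatible_comp sec_grig) simp_all
  moreover have "sec (r \<circ> g) False = sec r (act g) \<circ> sec g False"
      "sec (r \<circ> g) True = sec r (\<not> act g) \<circ> sec g True"
    using step by (auto simp: sec_comp grig_incl)
  ultimately have "compatible (sec (r \<circ> g) False) (sec (r \<circ> g) True)" by simp
  then show ?case by (simp only: o_def)
qed

section \<open>Which pairs are the sections of a group element\<close>

lemma grig_a_comp_node: "grig_a \<circ> node p s t = node (\<not> p) s t"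
  by (simp add: grig_a_node node_comp)

lemma node_swap:
  assumes "node False s t \<in> Grigorchuk" shows "node False t s \<in> Grigorchuk"
proof -
  have "grig_a \<circ> (node False s t \<circ> grig_a) \<in> Grigorchuk"
    by (intro grig_comp assms grig_incl) auto
  then show ?thesis by (simp add: grig_a_node node_comp)
qed

lemma node_mult:
  assumes "node False s t \<in> Grigorchuk" "node False s' t' \<in> Grigorchuk"
  shows "node False (s \<circ> s') (t \<circ> t') \<in> Grigorchuk"
  using grig_comp[OF assms] by (simp add: node_comp)

text \<open>Each generator is a section of b, c or d, and conjugation by a moves it to the first
  place.\<close>

lemma subdirect: "s \<in> Grigorchuk \<Longrightarrow> \<exists>t\<in>Grigorchuk. node False s t \<in> Grigorchuk"
proof (induction rule: grig_induct)
  case id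
  then show ?case using id_grig id_node by metis
next
  case (step r s)
  then obtain t where t: "t \<in> Grigorchuk" "node False s t \<in> Grigorchuk" by blast
  note gens = grig_incl[of grig_a] grig_incl[of grig_b] grig_incl[of grig_c] grig_incl[of grig_d]
  have "\<exists>t'\<in>Grigorchuk. node False r t' \<in> Grigorchuk"
    using step(1) gens id_grig grig_b_node grig_c_node grig_d_node node_swap
    by (elim insertE emptyE) (metis insertCI)+
  then obtain t' where "t' \<in> Grigorchuk" "node False r t' \<in> Grigorchuk" by blast
  then show ?case using node_mult t grig_comp by blast
qed

text \<open>The rigid stabiliser of the second subtree, which is shown in \<open>rist_iff\<close> to be $B$.\<close>

definition rist :: "(bool list \<Rightarrow> bool list) set" where
  "rist = {k \<in> Grigorchuk. node False id k \<in> Grigorchuk}"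

lemma rist_comp: "k \<in> rist \<Longrightarrow> l \<in> rist \<Longrightarrow> k \<circ> l \<in> rist"
  using node_mult[of id k id l] by (auto simp: rist_def grig_comp)

lemma id_rist: "id \<in> rist"
  using id_node id_grig by (auto simp: rist_def)

lemma b_rist: "grig_b \<in> rist"
  using grig_d_node grig_incl[of grig_d] grig_incl[of grig_b] by (auto simp: rist_def)

text \<open>Normality: some (s, g) lies in the group by \<open>subdirect\<close> and
  \<open>node_swap\<close>, and conjugating (1, k) by it gives (1,
  \<open>g \<circ> k \<circ> h\<close>).\<close>

lemma rist_conj:
  assumes k: "k \<in> rist" and g: "g \<in> Grigorchuk" and h: "h \<in> Grigorchuk" and gh: "g \<circ> h = id"
  shows "g \<circ> k \<circ> h \<in> rist"
proof -
  obtain s where s: "node False g s \<in> Grigorchuk" using subdirect g by blast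
  then have sg: "node False s g \<in> Grigorchuk" by (rule node_swap)
  obtain f where f: "f \<in> Grigorchuk" "node False s g \<circ> f = id" using grig_inverse sg by blast
  obtain p u v where puv: "f = node p u v" using grig_node_ex f by blast
  have "node False s g \<circ> f = node False id id" using f id_node by metis
  then have p: "\<not> p" and us: "s \<circ> u = id" and vg: "g \<circ> v = id"
    by (auto simp: puv node_comp split: if_splits)
  \<comment> \<open>Both are right inverses of \<open>g\<close>, which has a left inverse.\<close>
  have "v = h"
  proof -
    obtain g' where g': "g' \<circ> g = id" using grig_inverse g by blast
    have "v = (g' \<circ> g) \<circ> v" by (simp add: g')
    also have "\<dots> = (g' \<circ> g) \<circ> h" by (simp only: comp_assoc vg gh)
    finally show ?thesis by (simp add: g')
  qed
  have "node False s g \<circ> node False id k \<circ> f \<in> Grigorchuk"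
    using sg k f by (intro grig_comp) (auto simp: rist_def)
  moreover have "node False s g \<circ> node False id k \<circ> f = node False id (g \<circ> k \<circ> h)"
    using p us by (simp add: puv node_comp \<open>v = h\<close> comp_assoc)
  moreover have "g \<circ> k \<circ> h \<in> Grigorchuk"
    using k g h by (intro grig_comp) (auto simp: rist_def)
  ultimately show ?thesis by (simp add: rist_def)
qed

text \<open>This is (ad)^4 = 1: both squares have the sections (b, b). It reduces every word in a
  and d to one of the eight in \<open>dihedral\<close>.\<close>

lemma ad_rels:
  "(grig_a \<circ> grig_d) \<circ> (grig_a \<circ> grig_d) = (grig_d \<circ> grig_a) \<circ> (grig_d \<circ> grig_a)"
proof -
  have "(grig_a \<circ> grig_d) \<circ> (grig_a \<circ> grig_d) = node False grig_b grig_b"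
    unfolding grig_a_node grig_d_node by (simp add: node_comp)
  moreover have "(grig_d \<circ> grig_a) \<circ> (grig_d \<circ> grig_a) = node False grig_b grig_b"
    unfolding grig_a_node grig_d_node by (simp add: node_comp)
  ultimately show ?thesis by simp
qed

lemma grig_bcd: "grig_d (grig_b w) = grig_c w" "grig_c (grig_d w) = grig_b w"
  "grig_b (grig_c w) = grig_d w"
proof -
  have "grig_d (grig_b w) = grig_c w \<and> grig_c (grig_d w) = grig_b w \<and> grig_b (grig_c w) = grig_d w"
  proof (induction w)
    case (Cons x w)
    then show ?case by (cases x) (auto simp: grig_involution)
  qed simp
  then show "grig_d (grig_b w) = grig_c w" "grig_c (grig_d w) = grig_b w"
    "grig_b (grig_c w) = grig_d w" by auto
qed

definition dihedral :: "(bool list \<Rightarrow> bool list) set" where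
  "dihedral = {id, grig_a, grig_d, grig_a \<circ> grig_d, grig_d \<circ> grig_a, grig_a \<circ> grig_d \<circ> grig_a,
     grig_d \<circ> grig_a \<circ> grig_d, grig_a \<circ> grig_d \<circ> grig_a \<circ> grig_d}"

lemma dihedral_grig: "r \<in> dihedral \<Longrightarrow> r \<in> Grigorchuk"
  unfolding dihedral_def by (elim insertE emptyE; simp only:; intro grig_comp grig_incl id_grig) simp_all

lemma dihedral_a: "r \<in> dihedral \<Longrightarrow> grig_a \<circ> r \<in> dihedral"
  unfolding dihedral_def by (auto simp: fun_eq_iff grig_involution)

lemma dihedral_d: "r \<in> dihedral \<Longrightarrow> grig_d \<circ> r \<in> dihedral"
proof -
  have "grig_d (grig_a (grig_d (grig_a w))) = grig_a (grig_d (grig_a (grig_d w)))" for w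
    using fun_cong[OF ad_rels, of w] by simp
  moreover from this have "grig_d (grig_a (grig_d (grig_a (grig_d w)))) = grig_a (grig_d (grig_a w))" for w
    by (simp add: grig_involution)
  ultimately show "r \<in> dihedral \<Longrightarrow> grig_d \<circ> r \<in> dihedral"
    unfolding dihedral_def by (auto simp: fun_eq_iff grig_involution)
qed

text \<open>\<open>rist\<close> is normal and contains b, and c is d composed with b; modulo
  \<open>rist\<close> only words in a and d remain.\<close>

lemma dihedral_rist:
  "g \<in> Grigorchuk \<Longrightarrow> \<exists>r\<in>dihedral. \<exists>k\<in>rist. g = r \<circ> k"
proof (induction rule: grig_induct)
  case id
  show ?case using id_rist by (intro bexI[of _ id]) (auto simp: dihedral_def)
next
  case (step x g)
  then obtain r k where r: "r \<in> dihedral" and k: "k \<in> rist" and g: "g = r \<circ> k" by blast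
  have a: "\<exists>r'\<in>dihedral. \<exists>k'\<in>rist. x \<circ> g = r' \<circ> k'" if "x \<circ> r \<in> dihedral"
    using that k by (auto simp: g o_assoc)
  obtain r' where r': "r' \<in> Grigorchuk" "r \<circ> r' = id" "r' \<circ> r = id"
    using grig_inverse dihedral_grig r by blast
  have conj: "r' \<circ> grig_b \<circ> r \<circ> k \<in> rist"
    using rist_comp[OF rist_conj[OF b_rist r'(1) dihedral_grig[OF r] r'(3)] k] .
  \<comment> \<open>b passes \<open>r\<close> as a conjugate, which the factor in
    \<open>rist\<close> absorbs.\<close>
  have b: "grig_b \<circ> g = r \<circ> (r' \<circ> grig_b \<circ> r \<circ> k)"
    by (simp add: g o_assoc r'(2))
  have "grig_c = grig_d \<circ> grig_b" by (simp add: fun_eq_iff grig_bcd)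
  then have "grig_c \<circ> g = grig_d \<circ> (grig_b \<circ> g)" by (metis comp_assoc)
  then have c: "grig_c \<circ> g = (grig_d \<circ> r) \<circ> (r' \<circ> grig_b \<circ> r \<circ> k)"
    by (simp add: b comp_assoc)
  have "\<exists>r'\<in>dihedral. \<exists>k'\<in>rist. x \<circ> g = r' \<circ> k'"
    using step(1) a conj b c dihedral_a[OF r] dihedral_d[OF r] r by blast
  then show ?case by (simp only: o_def)
qed

text \<open>If (1, k) lies in the group, \<open>k\<close> is compatible with \<open>id\<close>,
  whose coordinates vanish.\<close>

lemma rist_trivial:
  "k \<in> rist \<Longrightarrow> act k = False \<and> ups k False = False \<and> ups k True = False"
  using compatible_sections[of "node False id k"] 
  by (auto simp: rist_def sec_node grig_Nil compatible_def)

text \<open>The rigid stabiliser is the kernel of the map to C_2 wr C_2: write \<open>k\<close> as a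
  dihedral word times an element of \<open>rist\<close>; only the trivial word has vanishing
  coordinates.\<close>

lemma rist_iff:
  "k \<in> rist \<longleftrightarrow> k \<in> Grigorchuk \<and> \<not> act k \<and> \<not> ups k False \<and> \<not> ups k True"
proof
  assume k: "k \<in> Grigorchuk \<and> \<not> act k \<and> \<not> ups k False \<and> \<not> ups k True"
  then obtain r l where r: "r \<in> dihedral" and l: "l \<in> rist" and eq: "k = r \<circ> l"
    using dihedral_rist by blast
  have G: "r \<in> Grigorchuk" "l \<in> Grigorchuk" using r l by (auto simp: rist_def dihedral_grig)
  have gens: "grig_a \<in> Grigorchuk" "grig_d \<in> Grigorchuk" by (auto intro: grig_incl)
  have "\<not> act r" "\<not> ups r False" "\<not> ups r True"
    using k rist_trivial[OF l] unfolding eq by (auto simp: act_comp ups_comp G)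
  then have "r = id"
    using r gens unfolding dihedral_def
    by (elim insertE emptyE) (simp_all add: act_comp ups_comp grig_comp)
  then show "k \<in> rist" using eq l by simp
qed (use rist_trivial in \<open>auto simp: rist_def\<close>)

text \<open>For sufficiency, \<open>subdirect\<close> supplies some (s, t') in the group.
  Compatibility with \<open>s\<close> fixes the coordinates of the second section, so
  \<open>t\<close> and \<open>t'\<close> differ by an element of \<open>rist\<close>, which corrects
  \<open>t'\<close> to \<open>t\<close>.\<close>

lemma node_grig_iff:
  "node p s t \<in> Grigorchuk \<longleftrightarrow> s \<in> Grigorchuk \<and> t \<in> Grigorchuk \<and> compatible s t"
proof
  assume n: "node p s t \<in> Grigorchuk"
  then have "s \<in> Grigorchuk \<and> t \<in> Grigorchuk" using grig_node_ex[of "node p s t"] by auto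
  moreover from this have "compatible s t"
    using compatible_sections[OF n] by (simp add: sec_node grig_Nil)
  ultimately show "s \<in> Grigorchuk \<and> t \<in> Grigorchuk \<and> compatible s t" by simp
next
  assume st: "s \<in> Grigorchuk \<and> t \<in> Grigorchuk \<and> compatible s t"
  then obtain t' where t': "t' \<in> Grigorchuk" "node False s t' \<in> Grigorchuk" using subdirect by blast
  then have c': "compatible s t'"
    using compatible_sections[of "node False s t'"] st by (simp add: sec_node grig_Nil)
  obtain u where u: "u \<in> Grigorchuk" "t' \<circ> u = id" "u \<circ> t' = id" using grig_inverse t' by blast
  have tt: "t = (t \<circ> u) \<circ> t'" by (simp add: comp_assoc u)
  have tu: "t \<circ> u \<in> Grigorchuk" using st u grig_comp by blast
  have *: "act t = (act (t \<circ> u) \<noteq> act t')" "ups t x = (ups (t \<circ> u) (x \<noteq> act t') \<noteq> ups t' x)" for x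
    using act_comp[OF tu t'(1)] ups_comp[OF tu t'(1)] by (simp_all flip: tt)
  have eq: "act t = act t'" "ups t x = ups t' x" for x
    using st c' by (cases x; simp add: compatible_def)+
  have "\<not> ups (t \<circ> u) y" for y
    using *(2)[of "y \<noteq> act t'"] eq(2)[of "y \<noteq> act t'"] by (cases "act t'") auto
  then have "t \<circ> u \<in> rist"
    unfolding rist_iff using tu *(1) eq(1) by auto
  then have "node False (id \<circ> s) ((t \<circ> u) \<circ> t') \<in> Grigorchuk"
    using t' by (intro node_mult) (simp_all add: rist_def)
  then have "node False s t \<in> Grigorchuk" by (simp flip: tt)
  then show "node p s t \<in> Grigorchuk"
    using grig_comp[OF grig_incl[of grig_a] \<open>node False s t \<in> Grigorchuk\<close>]
    by (cases p) (simp_all add: grig_a_comp_node)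
qed

subsection \<open>Nucleus and depth\<close>

text \<open>The elements of depth at most n, as \<open>portrait_depth_le\<close> shows. Nucleus
  elements lie in every level because the nucleus is closed under sections.\<close>

primrec lev :: "nat \<Rightarrow> (bool list \<Rightarrow> bool list) set" where
  "lev 0 = grig_nuc"
| "lev (Suc n) = {g \<in> Grigorchuk. \<forall>x. sec g x \<in> lev n}"

lemma nuc_grig: "g \<in> grig_nuc \<Longrightarrow> g \<in> Grigorchuk"
  using grig_incl id_grig by (auto simp: grig_nuc_def)

lemma sec_nuc: "g \<in> grig_nuc \<Longrightarrow> sec g x \<in> grig_nuc"
  unfolding grig_nuc_def by (elim insertE emptyE) simp_all

lemma lev_grig: "g \<in> lev n \<Longrightarrow> g \<in> Grigorchuk"
  by (cases n) (use nuc_grig in auto)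

lemma lev_Suc: "g \<in> lev n \<Longrightarrow> g \<in> lev (Suc n)"
proof (induction n arbitrary: g)
  case 0
  then show ?case using sec_nuc nuc_grig by simp
qed auto

lemma nuc_lev: "g \<in> grig_nuc \<Longrightarrow> g \<in> lev n"
  by (induction n) (use lev_Suc in auto)

lemma klein_four:
  "x \<in> {id, grig_b, grig_c, grig_d} \<Longrightarrow> y \<in> {id, grig_b, grig_c, grig_d} \<Longrightarrow>
    x \<circ> y \<in> {id, grig_b, grig_c, grig_d}"
proof -
  have "grig_d (grig_c w) = grig_b w" "grig_b (grig_d w) = grig_c w" "grig_c (grig_b w) = grig_d w" for w
    using grig_bcd grig_involution by metis+
  then have "grig_d \<circ> grig_c = grig_b" "grig_b \<circ> grig_d = grig_c" "grig_c \<circ> grig_b = grig_d"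
     "grig_d \<circ> grig_b = grig_c" "grig_c \<circ> grig_d = grig_b" "grig_b \<circ> grig_c = grig_d"
    by (auto simp: fun_eq_iff grig_bcd)
  then show "x \<in> {id, grig_b, grig_c, grig_d} \<Longrightarrow> y \<in> {id, grig_b, grig_c, grig_d} \<Longrightarrow>
    x \<circ> y \<in> {id, grig_b, grig_c, grig_d}"
    by (elim insertE emptyE) (simp_all add: grig_involution_comp)
qed

text \<open>If one factor is a, the sections are those of the other factor; otherwise the product
  stays in the Klein four-group of 1, b, c, d.\<close>

lemma sec_nuc_comp:
  assumes "g \<in> grig_nuc" "h \<in> grig_nuc" shows "sec (g \<circ> h) x \<in> grig_nuc"
proof (cases "g = grig_a \<or> h = grig_a")
  case True
  then show ?thesis
  proof
    assume "g = grig_a"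
    then have "sec (g \<circ> h) x = sec h x" using assms(2) by (simp add: sec_comp nuc_grig grig_incl)
    then show ?thesis using sec_nuc[OF assms(2)] by simp
  next
    assume "h = grig_a"
    then have "sec (g \<circ> h) x = sec g (\<not> x)" using assms(1) by (simp add: sec_comp nuc_grig grig_incl)
    then show ?thesis using sec_nuc[OF assms(1)] by simp
  qed
next
  case False
  then have "g \<circ> h \<in> {id, grig_b, grig_c, grig_d}" using assms klein_four by (auto simp: grig_nuc_def)
  then have "g \<circ> h \<in> grig_nuc" by (auto simp: grig_nuc_def)
  then show ?thesis by (rule sec_nuc)
qed

text \<open>A nucleus factor raises the depth by at most one; hence, by induction over words, every
  element has finite depth (\<open>grig_lev\<close>).\<close>

lemma nuc_comp_lev: "y \<in> grig_nuc \<Longrightarrow> g \<in> lev n \<Longrightarrow> y \<circ> g \<in> lev (Suc n)"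
proof (induction n arbitrary: g y)
  case 0
  then have "g \<in> grig_nuc" by simp
  then have "sec (y \<circ> g) x \<in> lev 0" for x using sec_nuc_comp[OF 0(1)] by simp
  moreover have "y \<circ> g \<in> Grigorchuk" using 0(1) \<open>g \<in> grig_nuc\<close> grig_comp nuc_grig by blast
  ultimately have "y \<circ> g \<in> lev (Suc 0)" by simp
  then show ?case by (simp only: o_def)
next
  case (Suc n)
  have G: "y \<in> Grigorchuk" "g \<in> Grigorchuk" using Suc nuc_grig lev_grig by blast+
  have "sec (y \<circ> g) x \<in> lev (Suc n)" for x
  proof -
    have "sec y (x \<noteq> act g) \<circ> sec g x \<in> lev (Suc n)"
      using Suc.prems by (intro Suc.IH sec_nuc) auto
    then show ?thesis using G by (simp only: sec_comp)
  qed
  then have "y \<circ> g \<in> lev (Suc (Suc n))"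
    using grig_comp[OF G] by (simp del: lev.simps add: lev.simps(2)[of "Suc n"])
  then show ?case by (simp only: o_def)
qed

lemma grig_lev: "g \<in> Grigorchuk \<Longrightarrow> \<exists>n. g \<in> lev n"
proof (induction rule: grig_induct)
  case id
  have "id \<in> lev 0" by (simp add: grig_nuc_def)
  then show ?case unfolding id_def by blast
next
  case (step s g)
  then obtain n where "g \<in> lev n" by blast
  moreover have "s \<in> grig_nuc" using step(1) by (auto simp: grig_nuc_def)
  ultimately have "s \<circ> g \<in> lev (Suc n)" by (rule nuc_comp_lev[rotated])
  then show ?case unfolding o_def by blast
qed

section \<open>The nucleus and the portraits\<close>

lemma tree_section_nuc: "g \<in> grig_nuc \<Longrightarrow> tree_section g u \<in> grig_nuc"
proof (induction u arbitrary: g)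
  case Nil
  then show ?case using grig_Nil[OF nuc_grig[OF Nil]] by simp
next
  case (Cons x u)
  then show ?case using sec_nuc nuc_grig tree_section_grig_Cons by metis
qed

lemma tree_section_lev: "g \<in> lev n \<Longrightarrow> n \<le> length u \<Longrightarrow> tree_section g u \<in> grig_nuc"
proof (induction n arbitrary: g u)
  case 0
  then show ?case using tree_section_nuc by simp
next
  case (Suc n)
  then obtain x v where "u = x # v" by (cases u) auto
  then show ?case using Suc tree_section_grig_Cons by auto
qed

text \<open>Along the letters \<open>True\<close> the sections of b run through the cycle b, c, d,
  so each section of b recurs at arbitrarily deep vertices.\<close>

lemma tree_section_b_power: "tree_section grig_b (replicate (3 * n) True @ u) = tree_section grig_b u"
proof (induction n)
  case (Suc n)
  have "replicate (3 * Suc n) True @ u = True # True # True # replicate (3 * n) True @ u"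
    by (simp add: numeral_eq_Suc)
  then show ?case using Suc by (simp add: tree_section_grig_Cons grig_incl)
qed simp

lemma nucleus_grig: "nucleus Grigorchuk = grig_nuc"
  unfolding nucleus_def
proof (rule Least_equality)
  show "absorbing Grigorchuk grig_nuc"
    unfolding absorbing_def
  proof (intro conjI ballI subsetI)
    fix g assume "g \<in> Grigorchuk"
    then obtain n where "g \<in> lev n" using grig_lev by blast
    then show "\<exists>n. \<forall>u. n \<le> length u \<longrightarrow> tree_section g u \<in> grig_nuc"
      using tree_section_lev by blast
  qed (simp_all add: nuc_grig, simp add: grig_nuc_def)
next
  fix M assume M: "absorbing Grigorchuk M"
  then obtain n where n: "\<And>u. n \<le> length u \<Longrightarrow> tree_section grig_b u \<in> M"
    unfolding absorbing_def using grig_incl[of grig_b] by blast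
  \<comment> \<open>The prefix of length 3n takes the vertex to level n or below without changing
    the section.\<close>
  have *: "tree_section grig_b u \<in> M" for u
    using n[of "replicate (3 * n) True @ u"] by (simp add: tree_section_b_power)
  have "grig_b \<in> M" "grig_c \<in> M" "grig_d \<in> M" "grig_a \<in> M" "id \<in> M"
    using *[of "[]"] *[of "[True]"] *[of "[True,True]"] *[of "[False]"] *[of "[False,False]"]
    by (simp_all add: tree_section_grig_Cons grig_incl id_grig)
  then show "grig_nuc \<le> M" by (simp add: grig_nuc_def)
qed

lemma has_portrait_unique: "has_portrait N g p \<Longrightarrow> has_portrait N g q \<Longrightarrow> p = q"
proof (induction arbitrary: q rule: has_portrait.induct)
  case (leaf g)
  then show ?case by (auto elim: has_portrait.cases)
next
  case (node g P)
  from node(4) obtain Q where "q = Node (root_perm g) Q" "\<And>x. has_portrait N (tree_section g [x]) (Q x)"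
    using node(1) by (cases rule: has_portrait.cases) auto
  then show ?case using node(3) by auto
qed

lemma has_portrait_ex: "g \<in> lev n \<Longrightarrow> \<exists>p. has_portrait grig_nuc g p"
proof (induction n arbitrary: g)
  case 0
  then show ?case using has_portrait.leaf by auto
next
  case (Suc n)
  then have "\<forall>x. \<exists>p. has_portrait grig_nuc (tree_section g [x]) p" by (simp add: sec_def)
  then obtain P where "\<And>x. has_portrait grig_nuc (tree_section g [x]) (P x)" by metis
  then show ?case using has_portrait.intros by blast
qed

lemma portrait_height_le:
  "has_portrait grig_nuc g p \<Longrightarrow> g \<in> Grigorchuk \<Longrightarrow> portrait_height p \<le> n \<longleftrightarrow> g \<in> lev n"
proof (induction arbitrary: n rule: has_portrait.induct)
  case (leaf g)
  then show ?case using nuc_lev by simp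
next
  case (node g P)
  have IH: "portrait_height (P x) \<le> m \<longleftrightarrow> sec g x \<in> lev m" for x m
    using node(3)[of x m] node(4) by (simp flip: sec_def)
  show ?case
  proof (cases n)
    case 0
    then show ?thesis using node(1) by simp
  next
    case (Suc m)
    have "portrait_height (Node (root_perm g) P) \<le> n \<longleftrightarrow> (\<forall>x. portrait_height (P x) \<le> m)"
      by (simp add: Suc)
    also have "\<dots> \<longleftrightarrow> g \<in> lev n" using node(4) by (simp add: IH Suc)
    finally show ?thesis .
  qed
qed

lemma portrait_depth_le:
  assumes "g \<in> Grigorchuk" shows "portrait_depth Grigorchuk g \<le> n \<longleftrightarrow> g \<in> lev n"
proof -
  obtain p where p: "has_portrait grig_nuc g p" using grig_lev has_portrait_ex assms by blast
  have "(THE q. has_portrait grig_nuc g q) = p"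
    using p has_portrait_unique by (intro the_equality)
  then show ?thesis
    using portrait_height_le[OF p assms]
    unfolding portrait_depth_def nucleus_portrait_def nucleus_grig by simp
qed

lemma portrait_growth_eq: "portrait_growth Grigorchuk n = card (lev n)"
proof -
  have "{g \<in> Grigorchuk. portrait_depth Grigorchuk g \<le> n} = lev n"
    using portrait_depth_le lev_grig by blast
  then show ?thesis by (simp add: portrait_growth_def)
qed

subsection \<open>Counting by classes\<close>

lemma node_lev: "node p s t \<in> lev (Suc n) \<longleftrightarrow> s \<in> lev n \<and> t \<in> lev n \<and> compatible s t"
proof -
  have "node p s t \<in> lev (Suc n) \<longleftrightarrow> s \<in> lev n \<and> t \<in> lev n"
    if "s \<in> Grigorchuk" "t \<in> Grigorchuk" "compatible s t"
    using that by (auto simp: node_grig_iff sec_node grig_Nil all_bool_eq)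
  moreover have "node p s t \<in> Grigorchuk" if "node p s t \<in> lev (Suc n)" using that by simp
  ultimately show ?thesis using node_grig_iff lev_grig by blast
qed

text \<open>The class depends on the sections only through their \<open>act\<close> and
  \<open>tau\<close>, so the class counts satisfy a closed recursion.\<close>

lemma cls_node:
  "s \<in> Grigorchuk \<Longrightarrow> t \<in> Grigorchuk \<Longrightarrow>
    cls (node p s t) = (p, tau s \<noteq> act t, tau t \<noteq> act s, act s \<noteq> act t)"
  by (simp add: cls_def ups_def tau_def sec_node grig_Nil)

lemma finite_lev: "finite (lev n)"
proof (induction n)
  case (Suc n)
  have "lev (Suc n) \<subseteq> (\<lambda>(p, s, t). node p s t) ` (UNIV \<times> lev n \<times> lev n)"
  proof
    fix g assume g: "g \<in> lev (Suc n)"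
    then have "g = node (act g) (sec g False) (sec g True)" using grig_eq_node by simp
    then show "g \<in> (\<lambda>(p, s, t). node p s t) ` (UNIV \<times> lev n \<times> lev n)" using g
      by (intro image_eqI[of _ _ "(act g, sec g False, sec g True)"]) simp_all
  qed
  then show ?case using Suc by (meson finite finite_SigmaI finite_imageI finite_subset)
qed (simp add: grig_nuc_def)

definition cnt :: "nat \<Rightarrow> bool \<Rightarrow> bool \<Rightarrow> bool \<Rightarrow> bool \<Rightarrow> nat" where
  "cnt n p u v t = card {g \<in> lev n. cls g = (p, u, v, t)}"

lemma card_lev: "card (lev n) = (\<Sum>p\<in>UNIV. \<Sum>u\<in>UNIV. \<Sum>v\<in>UNIV. \<Sum>t\<in>UNIV. cnt n p u v t)"
proof -
  have "card (lev n) = (\<Sum>x\<in>UNIV. card {g \<in> lev n. cls g = x})"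
    using sum.group[of "lev n" UNIV cls "\<lambda>_. 1::nat"] finite_lev by simp
  also have "\<dots> = (\<Sum>(p, u, v, t)\<in>UNIV. cnt n p u v t)"
    by (intro sum.cong) (auto simp: cnt_def)
  also have "\<dots> = (\<Sum>p\<in>UNIV. \<Sum>u\<in>UNIV. \<Sum>v\<in>UNIV. \<Sum>t\<in>UNIV. cnt n p u v t)"
    by (simp add: sum.cartesian_product flip: UNIV_Times_UNIV)
  finally show ?thesis .
qed

text \<open>For a given target class, the classes of a compatible pair (s, r) are determined by
  \<open>act s\<close> and \<open>ups r False\<close>. The two sums are the cases of
  \<open>act s\<close>, and \<open>y\<close> is \<open>ups r False\<close>.\<close>

lemma cnt_Suc:
  "cnt (Suc n) p u v t =
    (\<Sum>y\<in>UNIV. cnt n False y (y \<noteq> t) (u \<noteq> t) * cnt n t y y v) +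
    (\<Sum>y\<in>UNIV. cnt n True (y = t) y (u = t) * cnt n (\<not> t) y (\<not> y) (\<not> v))"
proof -
  define S where "S p u v t = {g \<in> lev n. cls g = (p, u, v, t)}" for p u v t
  \<comment> \<open>Here \<alpha> stands for \<open>act s\<close>. Then \<open>act r\<close> is
    \<open>\<alpha> \<noteq> t\<close>, and \<open>cls_node\<close> gives both \<open>tau\<close>
    values. Compatibility makes \<open>ups s\<close> equal to \<open>y\<close> at \<alpha> and to
    \<open>y \<noteq> act r\<close> at the other letter.\<close>
  define L where "L \<alpha> y = S \<alpha> (if \<alpha> then y = t else y) (if \<alpha> then y else y \<noteq> t) (u \<noteq> (\<alpha> \<noteq> t))"
    for \<alpha> y
  define R where "R \<alpha> y = S (\<alpha> \<noteq> t) y (\<alpha> \<noteq> y) (v \<noteq> \<alpha>)" for \<alpha> y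
  define f where "f = (\<lambda>(s, t). node p s t)"
  define J where "J = (UNIV :: (bool \<times> bool) set)"
  have lev: "g \<in> lev n" if "g \<in> S a b c d" for g a b c d using that by (simp add: S_def)
  have "{g \<in> lev (Suc n). cls g = (p, u, v, t)} = (\<Union>(\<alpha>, y)\<in>J. f ` (L \<alpha> y \<times> R \<alpha> y))"
  proof (intro equalityI subsetI)
    fix g assume g: "g \<in> {g \<in> lev (Suc n). cls g = (p, u, v, t)}"
    define s r where "s = sec g False" and "r = sec g True"
    have gsr: "g = node (act g) s r" using g grig_eq_node by (simp add: s_def r_def)
    have sr: "s \<in> lev n" "r \<in> lev n" "compatible s r"
      using g node_lev[of "act g" s r n] gsr by auto
    have "cls (node (act g) s r) = (p, u, v, t)" using g gsr by simp
    then have c: "p = act g" "u = (tau s \<noteq> act r)" "v = (tau r \<noteq> act s)" "t = (act s \<noteq> act r)"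
      using cls_node[of s r "act g"] sr lev_grig by auto
    \<comment> \<open>These turn the parameters of \<open>L\<close> and \<open>R\<close> at \<alpha>
      = \<open>act s\<close> and y = \<open>ups r False\<close> into the coordinates of
      \<open>s\<close> and \<open>r\<close>.\<close>
    have e: "(if act s then ups r False = t else ups r False) = ups s False"
      "(if act s then ups r False else ups r False \<noteq> t) = ups s True"
      "(u \<noteq> act r) = tau s" "(act s \<noteq> t) = act r" "(act s \<noteq> ups r False) = ups r True"
      "(v \<noteq> act s) = tau r"
      using sr(3) unfolding compatible_def c
      by (cases "act s"; cases "act r"; cases "ups s False"; cases "ups s True"; simp)+
    have "s \<in> L (act s) (ups r False)" "r \<in> R (act s) (ups r False)"
      unfolding L_def R_def S_def cls_def e using sr(1,2) by simp_all
    moreover have "g = f (s, r)" using gsr c by (simp add: f_def)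
    ultimately show "g \<in> (\<Union>(\<alpha>, y)\<in>J. f ` (L \<alpha> y \<times> R \<alpha> y))" unfolding J_def by blast
  next
    fix g assume "g \<in> (\<Union>(\<alpha>, y)\<in>J. f ` (L \<alpha> y \<times> R \<alpha> y))"
    then obtain \<alpha> y s r where sr: "s \<in> L \<alpha> y" "r \<in> R \<alpha> y" and g: "g = node p s r"
      by (auto simp: f_def)
    have l: "s \<in> lev n" "r \<in> lev n" using sr by (simp_all add: L_def R_def S_def)
    have "compatible s r" using sr
      unfolding L_def R_def S_def cls_def compatible_def by (cases \<alpha>; cases y; auto)
    moreover have "(tau s \<noteq> act r) = u" "(tau r \<noteq> act s) = v" "(act s \<noteq> act r) = t"
      using sr unfolding L_def R_def S_def cls_def by auto
    ultimately show "g \<in> {g \<in> lev (Suc n). cls g = (p, u, v, t)}"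
      using l lev_grig cls_node[of s r p] node_lev[of p s r n] unfolding g by simp
  qed
  then have "cnt (Suc n) p u v t = card (\<Union>(\<alpha>, y)\<in>J. f ` (L \<alpha> y \<times> R \<alpha> y))"
    by (simp add: cnt_def)
  also have "\<dots> = (\<Sum>(\<alpha>, y)\<in>J. card (f ` (L \<alpha> y \<times> R \<alpha> y)))"
  proof (subst card_UN_disjoint)
    show "\<forall>i\<in>J. finite (case i of (\<alpha>, y) \<Rightarrow> f ` (L \<alpha> y \<times> R \<alpha> y))"
      using finite_lev by (auto simp: L_def R_def S_def)
    \<comment> \<open>Disjointness: the index can be read off the second section.\<close>
    have key: "(\<alpha>, y) = (act (sec g True) \<noteq> t, ups (sec g True) False)"
      if "g \<in> f ` (L \<alpha> y \<times> R \<alpha> y)" for g \<alpha> y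
    proof -
      from that obtain s r where sr: "g = node p s r" "s \<in> L \<alpha> y" "r \<in> R \<alpha> y"
        unfolding f_def by auto
      then have "s \<in> Grigorchuk" "r \<in> Grigorchuk"
        using lev_grig[of s n] lev_grig[of r n] by (simp_all add: L_def R_def S_def)
      then show ?thesis using sr by (auto simp: sec_node grig_Nil R_def S_def cls_def)
    qed
    show "\<forall>i\<in>J. \<forall>j\<in>J. i \<noteq> j \<longrightarrow> (case i of (\<alpha>, y) \<Rightarrow> f ` (L \<alpha> y \<times> R \<alpha> y)) \<inter>
        (case j of (\<alpha>, y) \<Rightarrow> f ` (L \<alpha> y \<times> R \<alpha> y)) = {}"
    proof (intro ballI impI)
      fix i j :: "bool \<times> bool" assume "i \<noteq> j"
      then show "(case i of (\<alpha>, y) \<Rightarrow> f ` (L \<alpha> y \<times> R \<alpha> y)) \<inter>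
        (case j of (\<alpha>, y) \<Rightarrow> f ` (L \<alpha> y \<times> R \<alpha> y)) = {}"
        unfolding case_prod_beta using key[of _ "fst i" "snd i"] key[of _ "fst j" "snd j"]
        by (metis (no_types, lifting) disjoint_iff prod.collapse)
    qed
  qed (auto simp: J_def case_prod_beta)
  also have "\<dots> = (\<Sum>(\<alpha>, y)\<in>J. card (L \<alpha> y) * card (R \<alpha> y))"
    by (intro sum.cong refl)
      (auto simp: f_def inj_on_def card_image card_cartesian_product)
  also have "\<dots> = (\<Sum>\<alpha>\<in>UNIV. \<Sum>y\<in>UNIV. card (L \<alpha> y) * card (R \<alpha> y))"
    by (simp add: J_def sum.cartesian_product flip: UNIV_Times_UNIV)
  also have "\<dots> = (\<Sum>y\<in>UNIV. cnt n False y (y \<noteq> t) (u \<noteq> t) * cnt n t y y v) +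
    (\<Sum>y\<in>UNIV. cnt n True (y = t) y (u = t) * cnt n (\<not> t) y (\<not> y) (\<not> v))"
    by (simp add: UNIV_bool L_def R_def S_def cnt_def)
  finally show ?thesis .
qed

text \<open>The five classes belong to 1, a, b, c, d in this order, and they are distinct.\<close>

lemma cnt_0: "cnt 0 p u v t =
  (if (p, u, v, t) \<in> {(False, False, False, False), (True, False, False, False),
     (False, False, False, True), (False, False, True, True), (False, False, True, False)} then 1 else 0)"
proof -
  have *: "{g \<in> insert x A. Q g} = (if Q x then insert x {g \<in> A. Q g} else {g \<in> A. Q g})"
    for Q and x :: "bool list \<Rightarrow> bool list" and A by auto
  show ?thesis
    unfolding cnt_def lev.simps grig_nuc_def * cls_def
    by (cases p; cases u; cases v; cases t; simp)
qed

text \<open>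
  From level 1 on, \<open>cnt\<close> neither depends on its first class coordinate nor changes when
  the two middle ones are exchanged, so that six numbers describe it.
\<close>

definition state :: "nat \<Rightarrow> nat \<Rightarrow> nat \<Rightarrow> nat \<Rightarrow> nat \<Rightarrow> nat \<Rightarrow> nat \<Rightarrow> bool" where
  "state n P Q R S V W \<longleftrightarrow> (\<forall>p.
     cnt n p False False False = P \<and> cnt n p False False True = Q \<and>
     cnt n p True True False = R \<and> cnt n p True True True = S \<and>
     cnt n p False True False = V \<and> cnt n p True False False = V \<and>
     cnt n p False True True = W \<and> cnt n p True False True = W)"

lemma state_1: "state (Suc 0) 1 2 1 0 1 1"
  unfolding state_def by (simp add: cnt_Suc UNIV_bool cnt_0)

lemma state_Suc:
  assumes "state n P Q R S V W"
  shows "state (Suc n) (P * P + R * R + 2 * (W * W)) (2 * W * (P + R))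
     (Q * Q + S * S + 2 * (V * V)) (2 * V * (Q + S)) (P * Q + R * S + 2 * (V * W))
     (W * (Q + S) + V * (P + R))"
  using assms unfolding state_def
  by (simp add: cnt_Suc UNIV_bool algebra_simps)

lemma state_ex: "\<exists>P Q R S V W. state (Suc n) P Q R S V W"
proof (induction n)
  case 0
  show ?case using state_1 by blast
next
  case (Suc n)
  then show ?case using state_Suc by blast
qed

lemma card_lev_state: "state n P Q R S V W \<Longrightarrow> card (lev n) = 2 * (P + Q + R + S + 2 * V + 2 * W)"
  unfolding card_lev state_def by (simp add: UNIV_bool)

subsection \<open>The growth rate\<close>

definition growth :: "nat \<Rightarrow> real" where
  "growth n = real (card (lev n))"

lemma growth_0: "growth 0 = 5"
  by (simp add: growth_def card_lev UNIV_bool cnt_0 del: lev.simps)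

lemma growth_2: "growth 2 = 68"
  and growth_8: "growth 8 =
    26650157288558330635926792369464002035387490132584401265320935709081045747892224"
proof -
  note s2 = state_Suc[OF state_1, simplified]
  note s3 = state_Suc[OF s2, simplified]
  note s4 = state_Suc[OF s3, simplified]
  note s5 = state_Suc[OF s4, simplified]
  note s6 = state_Suc[OF s5, simplified]
  note s7 = state_Suc[OF s6, simplified]
  note s8 = state_Suc[OF s7, simplified]
  show "growth 2 = 68"
    using card_lev_state[OF s2] by (simp add: growth_def numeral_eq_Suc del: lev.simps)
  have "8 = Suc (Suc (Suc (Suc (Suc (Suc (Suc (Suc 0)))))))" by simp
  from arg_cong[OF this, of lev] show "growth 8 =
      26650157288558330635926792369464002035387490132584401265320935709081045747892224"
    unfolding growth_def using card_lev_state[OF s8] by (simp del: lev.simps)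
qed

text \<open>With A = P + Q, B = R + S, C = V + W the old total is 2(A + B + 2C) and the new one
  2(A^2 + B^2 + 2C^2 + 2C(A + B)); completing the square leaves D = 2(A - B). Thus \<open>D\<close>
  compares the elements with both \<open>ups\<close> values \<open>False\<close> to those with both
  \<open>True\<close>.\<close>

lemma growth_Suc_Suc:
  "\<exists>D. 4 * growth (Suc (Suc n)) = growth (Suc n) ^ 2 + D ^ 2 \<and> \<bar>D\<bar> \<le> growth (Suc n)"
proof -
  obtain P Q R S V W where s: "state (Suc n) P Q R S V W" using state_ex by blast
  define D where "D = 2 * (real P + Q - R - S)"
  have "4 * growth (Suc (Suc n)) = growth (Suc n) ^ 2 + D ^ 2"
    unfolding growth_def card_lev_state[OF s] card_lev_state[OF state_Suc[OF s]] D_def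
    by (simp add: algebra_simps power2_eq_square)
  moreover have "\<bar>D\<bar> \<le> growth (Suc n)"
    unfolding growth_def card_lev_state[OF s] D_def by simp
  ultimately show ?thesis by blast
qed

lemma growth_1: "growth (Suc 0) = 16"
  using card_lev_state[OF state_1] by (simp add: growth_def)

lemma growth_lower: "growth n ^ 2 \<le> 4 * growth (Suc n)"
proof (cases n)
  case 0
  then show ?thesis by (simp add: growth_0 growth_1)
next
  case (Suc m)
  then show ?thesis using growth_Suc_Suc[of m] by auto
qed

text \<open>This starts at level 1: between levels 0 and 1 it would read 32 \<le> 25. Hence
  \<open>up\<close> decreases only from index 1 on.\<close>

lemma growth_upper: "2 * growth (Suc (Suc n)) \<le> growth (Suc n) ^ 2"
proof -
  obtain D where D: "4 * growth (Suc (Suc n)) = growth (Suc n) ^ 2 + D ^ 2" "\<bar>D\<bar> \<le> growth (Suc n)"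
    using growth_Suc_Suc by blast
  have "D ^ 2 \<le> growth (Suc n) ^ 2" using D(2) by (metis abs_ge_zero power2_abs power_mono)
  then show ?thesis using D(1) by simp
qed

text \<open>Keeps the arguments of the logarithms in \<open>lo\<close> and \<open>up\<close> above
  1; 5 persists because 25/4 exceeds it.\<close>

lemma growth_ge: "growth n \<ge> 5"
proof (induction n)
  case (Suc n)
  have "5 * 5 \<le> growth n * growth n" using Suc by (intro mult_mono) auto
  then show ?case using growth_lower[of n] Suc by (cases n) (auto simp: growth_1 power2_eq_square)
qed (simp add: growth_0)

text \<open>Dividing by 4 and by 2 turns \<open>growth_lower\<close> and \<open>growth_upper\<close>
  into monotonicity. The gap \<open>up n - lo n\<close> is ln 2 / 2^n.\<close>

definition lo :: "nat \<Rightarrow> real" where "lo n = ln (growth n / 4) / 2 ^ n"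
definition up :: "nat \<Rightarrow> real" where "up n = ln (growth n / 2) / 2 ^ n"

lemma growth_eq_exp: "growth n = 4 * exp (lo n * 2 ^ n)" "growth n = 2 * exp (up n * 2 ^ n)"
  using growth_ge[of n] by (simp_all add: lo_def up_def)

lemma lo_Suc: "lo n \<le> lo (Suc n)"
proof -
  have "(growth n / 4) ^ 2 \<le> growth (Suc n) / 4"
    using growth_lower[of n] by (simp add: power2_eq_square)
  then have "ln ((growth n / 4) ^ 2) \<le> ln (growth (Suc n) / 4)"
    using growth_ge[of n] by (intro ln_mono) auto
  moreover have "ln ((growth n / 4) ^ 2) = 2 * ln (growth n / 4)"
    by (simp only: ln_realpow of_nat_numeral)
  ultimately show ?thesis by (simp add: lo_def field_simps)
qed

lemma up_Suc: "up (Suc (Suc n)) \<le> up (Suc n)"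
proof -
  have "growth (Suc (Suc n)) / 2 \<le> (growth (Suc n) / 2) ^ 2"
    using growth_upper[of n] by (simp add: power2_eq_square)
  then have "ln (growth (Suc (Suc n)) / 2) \<le> ln ((growth (Suc n) / 2) ^ 2)"
    using growth_ge[of "Suc (Suc n)"] by (intro ln_mono) auto
  moreover have "ln ((growth (Suc n) / 2) ^ 2) = 2 * ln (growth (Suc n) / 2)"
    by (simp only: ln_realpow of_nat_numeral)
  ultimately show ?thesis by (simp add: up_def field_simps)
qed

lemma lo_le_up: "lo n \<le> up n"
  unfolding lo_def up_def using growth_ge[of n] by (intro divide_right_mono ln_mono) auto

lemma lo_mono: "m \<le> n \<Longrightarrow> lo m \<le> lo n"
  using lift_Suc_mono_le[of lo, OF lo_Suc] .

lemma up_antimono: "0 < m \<Longrightarrow> m \<le> n \<Longrightarrow> up n \<le> up m"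
proof (induction n)
  case (Suc n)
  show ?case
  proof (cases "m = Suc n")
    case False
    then obtain k where "n = Suc k" using Suc.prems by (cases n) auto
    then show ?thesis using up_Suc[of k] Suc False by auto
  qed simp
qed simp

text \<open>The supremum of \<open>lo\<close> works: every \<open>lo n\<close> lies below every
  \<open>up m\<close> with m > 0, by comparison at the larger index.\<close>

lemma rate_ex: "\<exists>\<gamma>. (\<forall>n. lo n \<le> \<gamma>) \<and> (\<forall>n>0. \<gamma> \<le> up n)"
proof -
  have le: "lo n \<le> up m" if "0 < m" for m n
    using lo_mono[of n "max m n"] lo_le_up[of "max m n"] up_antimono[of m "max m n"] that by auto
  have bdd: "bdd_above (range lo)" using le[of 1] by (auto intro!: bdd_aboveI[of _ "up 1"])
  have "lo n \<le> (SUP n. lo n)" for n by (rule cSUP_upper[OF _ bdd]) simp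
  moreover have "(SUP n. lo n) \<le> up m" if "m > 0" for m
    using le[OF that] by (intro cSUP_least) auto
  ultimately show ?thesis by blast
qed

section \<open>Numerical bounds for the growth rate\<close>

lemma exp_ge_power:
  fixes x r s :: real
  assumes "r \<le> exp x" "0 \<le> r" "s \<le> r ^ n"
  shows "s \<le> exp (of_nat n * x)"
proof -
  have "s \<le> exp x ^ n" using assms power_mono[of r "exp x" n] by linarith
  then show ?thesis by (simp add: exp_of_nat_mult)
qed

lemma lo_2: "705/1000 < lo 2"
proof -
  \<comment> \<open>The claim is exp 2.82 < 17 = 68/4. Start from 1 + x \<le> exp x at x = -2.82/512
    and raise to the eighth power three times, rounding down.\<close>
  have "994492/1000000 \<le> exp (-141/25600 :: real)"
    using exp_ge_add_one_self[of "-141/25600 :: real"] by linarith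
  from exp_ge_power[OF this, of "95677/100000" 8]
  have "95677/100000 \<le> exp (-141/3200 :: real)" by (simp add: power_divide)
  from exp_ge_power[OF this, of "70219/100000" 8]
  have "70219/100000 \<le> exp (-141/400 :: real)" by (simp add: power_divide)
  from exp_ge_power[OF this, of "591/10000" 8]
  have "591/10000 \<le> exp (-141/50 :: real)" by (simp add: power_divide)
  then have "exp (141/50) < (17::real)" by (simp add: exp_minus field_simps)
  then have "ln (exp (141/50)) < ln (17::real)" by (subst ln_less_cancel_iff) auto
  then show ?thesis by (simp add: lo_def growth_2)
qed

lemma up_8: "up 8 < 715/1000"
proof -
  \<comment> \<open>The claim is that half of \<open>growth 8\<close>, about 1.33 * 10^79, is below
    exp(256 * 0.715). Since 143/51200 is the exponent over 16^4, four sixteenth powers reach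
    it.\<close>
  have "1002792/1000000 \<le> exp (143/51200 :: real)"
    using exp_ge_add_one_self[of "143/51200 :: real"] by linarith
  from exp_ge_power[OF this, of "104561/100000" 16]
  have "104561/100000 \<le> exp (143/3200 :: real)" by (simp add: power_divide)
  from exp_ge_power[OF this, of "204134/100000" 16]
  have "204134/100000 \<le> exp (143/200 :: real)" by (simp add: power_divide)
  from exp_ge_power[OF this, of "90917" 16]
  have "90917 \<le> exp (286/25 :: real)" by (simp add: power_divide)
  from exp_ge_power[OF this, of "2 * 10 ^ 79" 16]
  have "2 * 10 ^ 79 \<le> exp (4576/25 :: real)" by simp
  then have "growth 8 / 2 < exp (4576/25)" by (simp add: growth_8)
  then have "ln (growth 8 / 2) < ln (exp (4576/25))"
    using growth_ge[of 8] by (subst ln_less_cancel_iff) auto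
  then show ?thesis by (simp add: up_def)
qed

theorem theorem1p1:
  shows "\<exists>\<gamma>::real. \<gamma> > 0 \<and>
           (\<forall>n::nat. 1/4 * exp (\<gamma> * 2 ^ n) \<le> real (portrait_growth Grigorchuk n) \<and>
                     real (portrait_growth Grigorchuk n) \<le> 4 * exp (\<gamma> * 2 ^ n)) \<and>
           \<bar>\<gamma> - 71/100\<bar> < 5/1000"
proof -
  obtain \<gamma> where lo: "\<And>n. lo n \<le> \<gamma>" and up: "\<And>n. n > 0 \<Longrightarrow> \<gamma> \<le> up n" using rate_ex by blast
  have num: "705/1000 < \<gamma>" "\<gamma> < 715/1000"
    using lo[of 2] lo_2 up[of 8] up_8 by simp_all
  have "growth n \<le> 4 * exp (\<gamma> * 2 ^ n)" for n
    unfolding growth_eq_exp(1)[of n] using lo[of n] by (simp add: mult_right_mono)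
  moreover have "1/4 * exp (\<gamma> * 2 ^ n) \<le> growth n" for n
  proof (cases "n = 0")
    case True
    \<comment> \<open>The bound by \<open>up\<close> begins at index 1; at level 0 it is enough that
      \<gamma> < 1 and e \<le> 3.\<close>
    have "exp \<gamma> \<le> exp 1" using num by simp
    then have "exp \<gamma> \<le> 3" using exp_le by linarith
    then show ?thesis using True by (simp add: growth_0)
  next
    case False
    then have "exp (\<gamma> * 2 ^ n) \<le> exp (up n * 2 ^ n)" using up[of n] by (simp add: mult_right_mono)
    then show ?thesis unfolding growth_eq_exp(2)[of n] using exp_gt_zero[of "up n * 2 ^ n"] by linarith
  qed
  ultimately show ?thesis
    using num by (intro exI[of _ \<gamma>]) (auto simp: growth_def portrait_growth_eq abs_if)
qed

end
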